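(* Let $\Bbbk$ be a field of characteristic zero, $N$ a positive integer, $M=\bigoplus_{k\in\frac{1}{N}\mathbb{Z}}M_k$ a graded algebra of type $\frac{1}{N}\mathbb{Z}$ over $\Bbbk$, $\partial$ a derivation of $M$ of degree $2$, and $\mathcal{E}_4\in M_4$. Let $\widetilde{M}=M[\mathcal{E}_2]$ be the polynomial ring over $M$ in an indeterminate $\mathcal{E}_2$ of degree $2$, and let $\mathscr{D}$ be the derivation of $\widetilde{M}$ with $\mathscr{D}(f)=\partial f+k\,\mathcal{E}_2 f$ for $f\in M_k$ and $\mathscr{D}(\mathcal{E}_2)=\mathcal{E}_4+\mathcal{E}_2^2$. For any integer $n\ge0$ and any homogeneous $f\in M_k$, define $$\vartheta^{(n)}f:=\mathscr{D}^{n+1}f-(n+k)[\mathcal{E}_2,f]_{\mathscr{D},n},\qquad \vartheta^{(n)}\mathcal{E}_2:=\big(1+(-1)^n\big)\mathscr{D}^{n+1}\mathcal{E}_2-(n+2)[\mathcal{E}_2,\mathcal{E}_2]_{\mathscr{D},n}.$$ Then $\vartheta^{(n)}f\in M_{k+2+2n}$ and $\vartheta^{(n)}\mathcal{E}_2\in M_{4+2n}$.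
   Context: A graded algebra of type $\frac{1}{N}\mathbb{Z}$ over $\Bbbk$ is a commutative, associative $\Bbbk$-algebra with unit $M=\bigoplus_{k\in\frac{1}{N}\mathbb{Z}}M_k$ with $M_kM_l\subseteq M_{k+l}$, $1\in M_0$, and $\dim_\Bbbk M_k<\infty$; elements of $M_k$ are homogeneous of degree $k$. A derivation has degree $2$ if it maps $M_k$ into $M_{k+2}$. $\widetilde{M}$ is graded with $\mathcal{E}_2$ of degree $2$, and $\mathscr{D}$ maps $\widetilde{M}_k$ to $\widetilde{M}_{k+2}$; $\mathscr{D}^j$ denotes the $j$-th iterate. $(x)_0=1$, $(x)_n=x(x+1)\cdots(x+n-1)$. For homogeneous $f\in\widetilde{M}_k$, $g\in\widetilde{M}_l$ and $n\ge0$, $$[f,g]_{\mathscr{D},n}:=\sum_{j=0}^n(-1)^j\frac{(k+j)_{n-j}(l+n-j)_j}{j!(n-j)!}\,\mathscr{D}^{j}f\,\mathscr{D}^{n-j}g;$$ in particular $\mathcal{E}_2$ is treated as having degree $2$ in $[\mathcal{E}_2,f]_{\mathscr{D},n}$ and $[\mathcal{E}_2,\mathcal{E}_2]_{\mathscr{D},n}$. *)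

theory Defs
  imports Complex_Main "HOL-Computational_Algebra.Polynomial"
begin

definition fractional_degrees :: "nat \<Rightarrow> rat set" where
  "fractional_degrees N = range (\<lambda>i::int. of_int i / of_nat N)"

text \<open>Only the values of \<open>M\<close> on \<^term>\<open>fractional_degrees N\<close> are meaningful;
  \<open>direct_sum\<close> is the usual unique decomposition into finitely supported families.\<close>

locale graded_algebra = vector_space scale
  for scale :: "'k::field_char_0 \<Rightarrow> 'a::comm_ring_1 \<Rightarrow> 'a" +
  fixes N :: nat and M :: "rat \<Rightarrow> 'a set"
  assumes N_pos: "N > 0"
    and scale_mult_left: "scale c (x * y) = scale c x * y"
    and subspace_component: "k \<in> fractional_degrees N \<Longrightarrow> subspace (M k)"
    and direct_sum: "\<exists>!g :: rat \<Rightarrow> 'a.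
          (\<forall>k\<in>fractional_degrees N. g k \<in> M k) \<and>
          (\<forall>k. k \<notin> fractional_degrees N \<longrightarrow> g k = 0) \<and>
          finite {k. g k \<noteq> 0} \<and> x = (\<Sum>k | g k \<noteq> 0. g k)"
    and mult_component: "k \<in> fractional_degrees N \<Longrightarrow> l \<in> fractional_degrees N \<Longrightarrow>
          f \<in> M k \<Longrightarrow> g \<in> M l \<Longrightarrow> f * g \<in> M (k + l)"
    and one_component: "1 \<in> M 0"
    and finite_dim_component: "k \<in> fractional_degrees N \<Longrightarrow> \<exists>B. finite B \<and> span B = M k"

definition is_derivation :: "('k \<Rightarrow> 'b \<Rightarrow> 'b) \<Rightarrow> ('b \<Rightarrow> 'b::comm_ring_1) \<Rightarrow> bool" where
  "is_derivation scale d \<longleftrightarrow>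
     (\<forall>x y. d (x + y) = d x + d y) \<and>
     (\<forall>c x. d (scale c x) = scale c (d x)) \<and>
     (\<forall>x y. d (x * y) = d x * y + x * d y)"

definition has_degree_2 :: "nat \<Rightarrow> (rat \<Rightarrow> 'a set) \<Rightarrow> ('a \<Rightarrow> 'a) \<Rightarrow> bool" where
  "has_degree_2 N M d \<longleftrightarrow> (\<forall>k\<in>fractional_degrees N. d ` M k \<subseteq> M (k + 2))"

text \<open>The polynomial ring over \<open>M\<close> is \<^typ>\<open>'a poly\<close>; elements of \<open>M\<close> embed as constant
  polynomials \<open>[:f:]\<close>, and the indeterminate is \<open>E2\<close>.\<close>

definition E2 :: "'a::comm_ring_1 poly" where
  "E2 = [:0, 1:]"

definition scale_poly :: "('k \<Rightarrow> 'a \<Rightarrow> 'a) \<Rightarrow> 'k \<Rightarrow> 'a poly \<Rightarrow> 'a::comm_ring_1 poly" where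
  "scale_poly scale c p = map_poly (scale c) p"

definition extends_derivation ::
    "('k::field_char_0 \<Rightarrow> 'a \<Rightarrow> 'a) \<Rightarrow> nat \<Rightarrow> (rat \<Rightarrow> 'a set) \<Rightarrow> ('a \<Rightarrow> 'a) \<Rightarrow> 'a \<Rightarrow>
     ('a poly \<Rightarrow> 'a::comm_ring_1 poly) \<Rightarrow> bool" where
  "extends_derivation scale N M d E4 D \<longleftrightarrow>
     is_derivation (scale_poly scale) D \<and>
     (\<forall>k\<in>fractional_degrees N. \<forall>f\<in>M k.
        D [:f:] = [:d f:] + scale_poly scale (of_rat k) (E2 * [:f:])) \<and>
     D E2 = [:E4:] + E2 ^ 2"

text \<open>The degrees \<open>k\<close> of \<open>f\<close> and \<open>l\<close> of \<open>g\<close> are passed explicitly, since they enter the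
  coefficients and are not determined by the elements (\<open>0\<close> is homogeneous of every degree).
  The coefficients are rational numbers, mapped into the base field by \<^term>\<open>of_rat\<close>.\<close>

definition RC_bracket ::
    "('k::field_char_0 \<Rightarrow> 'a \<Rightarrow> 'a) \<Rightarrow> ('a poly \<Rightarrow> 'a poly) \<Rightarrow> rat \<Rightarrow> rat \<Rightarrow> nat \<Rightarrow>
     'a poly \<Rightarrow> 'a poly \<Rightarrow> 'a::comm_ring_1 poly" where
  "RC_bracket scale D k l n f g =
     (\<Sum>j=0..n. scale_poly scale
        (of_rat ((- 1) ^ j *
           (pochhammer (k + of_nat j) (n - j) * pochhammer (l + of_nat n - of_nat j) j) /
           (fact j * fact (n - j))))
        ((D ^^ j) f * (D ^^ (n - j)) g))"

definition theta ::
    "('k::field_char_0 \<Rightarrow> 'a \<Rightarrow> 'a) \<Rightarrow> ('a poly \<Rightarrow> 'a poly) \<Rightarrow> nat \<Rightarrow> rat \<Rightarrow>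
     'a \<Rightarrow> 'a::comm_ring_1 poly" where
  "theta scale D n k f =
     (D ^^ (n + 1)) [:f:] -
     scale_poly scale (of_rat (of_nat n + k)) (RC_bracket scale D 2 k n E2 [:f:])"

definition theta_E2 ::
    "('k::field_char_0 \<Rightarrow> 'a \<Rightarrow> 'a) \<Rightarrow> ('a poly \<Rightarrow> 'a poly) \<Rightarrow> nat \<Rightarrow> 'a::comm_ring_1 poly" where
  "theta_E2 scale D n =
     (1 + (- 1) ^ n) * (D ^^ (n + 1)) E2 -
     (of_nat n + 2) * RC_bracket scale D 2 2 n E2 E2"

end

theory Submission
  imports Defs
begin

text \<open>
  Let \<open>\<delta> = \<partial>/\<partial>E2\<close>, an operator of degree \<open>-2\<close> on \<open>M[E2]\<close>. On homogeneous elements of degree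
  \<open>k\<close> the commutator \<open>\<delta> D - D \<delta>\<close> is multiplication by \<open>k\<close>, so if \<open>D (\<delta> f) = 0\<close>
  then \<open>\<delta> (D ^^ m) f = m (k + m - 1) (D ^^ (m - 1)) f\<close> for \<open>m \<ge> 1\<close>. The coefficients of the
  Rankin--Cohen bracket are exactly those for which \<open>\<delta> [f, g]\<close> telescopes to its two boundary
  terms. Hence \<open>\<delta>\<close> annihilates both expressions in question; as they are homogeneous and the
  characteristic is zero, they lie in the corresponding component of \<open>M\<close>.
\<close>

section \<open>Degree arithmetic and the formal derivative with respect to \<open>E2\<close>\<close>

lemma fractional_degrees_add:
  assumes "k \<in> fractional_degrees N" "l \<in> fractional_degrees N"
  shows "k + l \<in> fractional_degrees N"
proof -
  obtain i j :: int where "k = of_int i / of_nat N" "l = of_int j / of_nat N"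
    using assms unfolding fractional_degrees_def by blast
  then have "k + l = of_int (i + j) / of_nat N" by (simp add: add_divide_distrib)
  then show ?thesis unfolding fractional_degrees_def by blast
qed

lemma of_int_fractional_degrees:
  assumes "N > 0"
  shows "of_int i \<in> fractional_degrees N"
proof -
  have "(of_int i :: rat) = of_int (i * int N) / of_nat N" using assms by simp
  then show ?thesis unfolding fractional_degrees_def by blast
qed

text \<open>The library's \<^const>\<open>pderiv\<close> requires coefficients without zero divisors.\<close>

definition formal_deriv :: "'a::comm_ring_1 poly \<Rightarrow> 'a poly" where
  "formal_deriv p = Abs_poly (\<lambda>n. of_nat (Suc n) * coeff p (Suc n))"

lemma coeff_formal_deriv: "coeff (formal_deriv p) n = of_nat (Suc n) * coeff p (Suc n)"
proof -
  have "coeff (formal_deriv p) = (\<lambda>n. of_nat (Suc n) * coeff p (Suc n))"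
    unfolding formal_deriv_def by (rule coeff_Abs_poly[of "degree p"]) (simp add: coeff_eq_0)
  then show ?thesis by simp
qed

lemma formal_deriv_0 [simp]: "formal_deriv 0 = 0"
  and formal_deriv_const: "formal_deriv [:a:] = 0"
  and formal_deriv_E2: "formal_deriv E2 = 1"
  and formal_deriv_add: "formal_deriv (p + q) = formal_deriv p + formal_deriv q"
  and formal_deriv_diff: "formal_deriv (p - q) = formal_deriv p - formal_deriv q"
  and formal_deriv_smult: "formal_deriv (smult c p) = smult c (formal_deriv p)"
  by (rule poly_eqI,
      simp add: coeff_formal_deriv E2_def coeff_pCons algebra_simps split: nat.split)+

lemma formal_deriv_pCons: "formal_deriv (pCons a p) = p + pCons 0 (formal_deriv p)"
  by (rule poly_eqI) (simp add: coeff_formal_deriv coeff_pCons algebra_simps split: nat.split)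

lemma formal_deriv_mult: "formal_deriv (p * q) = formal_deriv p * q + p * formal_deriv q"
  by (induction p)
    (simp_all add: formal_deriv_add formal_deriv_smult formal_deriv_pCons algebra_simps)

lemma formal_deriv_sum: "formal_deriv (sum f A) = (\<Sum>i\<in>A. formal_deriv (f i))"
  by (induction A rule: infinite_finite_induct) (simp_all add: formal_deriv_add)

section \<open>Coefficients of the Rankin--Cohen bracket\<close>

definition RC_coeff :: "rat \<Rightarrow> rat \<Rightarrow> nat \<Rightarrow> nat \<Rightarrow> rat" where
  "RC_coeff k l n j = (- 1) ^ j *
     (pochhammer (k + of_nat j) (n - j) * pochhammer (l + of_nat n - of_nat j) j) /
     (fact j * fact (n - j))"

text \<open>Both sides are coefficients of \<open>(D ^^ j) f * (D ^^ (n - Suc j)) g\<close> in the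
  derivative of the bracket: the left one comes from summand \<open>Suc j\<close> with
  \<open>f\<close> differentiated, the other from summand \<open>j\<close> with \<open>g\<close>
  differentiated. The opposite signs are what makes the sum telescope.\<close>

lemma RC_coeff_Suc:
  assumes "j < n"
  shows "RC_coeff k l n (Suc j) * (of_nat (Suc j) * (k + of_nat j)) =
         - (RC_coeff k l n j * (of_nat (n - j) * (l + of_nat (n - j) - 1)))"
proof -
  obtain m where m: "n = Suc (j + m)" using assms less_iff_Suc_add by blast
  \<comment> \<open>\<open>P\<close> and \<open>Q\<close> are the Pochhammer factors shared by both
    coefficients: passing from \<open>j\<close> to \<open>Suc j\<close> drops
    \<open>k + of_nat j\<close> from the first symbol and adds \<open>l + of_nat m\<close> to the
    second.\<close>
  define P where "P = pochhammer (k + of_nat j + 1) m"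
  define Q where "Q = pochhammer (l + of_nat m + 1) j"
  have P: "pochhammer (k + of_nat j) (Suc m) = (k + of_nat j) * P"
    by (simp add: pochhammer_rec P_def)
  have Q: "pochhammer (l + of_nat m) (Suc j) = (l + of_nat m) * Q"
    by (simp add: pochhammer_rec Q_def)
  have c1: "RC_coeff k l n (Suc j) = - ((- 1) ^ j) * (P * ((l + of_nat m) * Q)) /
      (of_nat (Suc j) * fact j * fact m)"
    using Q by (simp add: RC_coeff_def m P_def algebra_simps)
  have c0: "RC_coeff k l n j = (- 1) ^ j * (((k + of_nat j) * P) * Q) /
      (fact j * (of_nat (Suc m) * fact m))"
    using P by (simp add: RC_coeff_def m Q_def algebra_simps Suc_diff_le)
  have nm: "n - j = Suc m" using m by simp
  have "RC_coeff k l n (Suc j) * (of_nat (Suc j) * (k + of_nat j)) =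
      - ((- 1) ^ j) * P * (l + of_nat m) * Q * (k + of_nat j) / (fact j * fact m)"
    unfolding c1 by (simp add: divide_simps del: of_nat_Suc)
  moreover have "RC_coeff k l n j * (of_nat (Suc m) * (l + of_nat (Suc m) - 1)) =
      (- 1) ^ j * P * (l + of_nat m) * Q * (k + of_nat j) / (fact j * fact m)"
    unfolding c0 by (simp add: divide_simps del: of_nat_Suc)
  ultimately show ?thesis unfolding nm by simp
qed

text \<open>Used where \<open>E2\<close>, of degree 2, enters a bracket: the factorial cancels and
  the boundary coefficients become \<open>of_nat (Suc n)\<close> up to sign.\<close>

lemma pochhammer_2: "pochhammer (2 :: rat) n = of_nat (Suc n) * fact n"
proof -
  have "pochhammer (1 :: rat) (Suc n) = pochhammer 2 n"
    by (simp add: pochhammer_rec)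
  then show ?thesis by (simp flip: pochhammer_fact)
qed

lemma RC_coeff_2_0: "RC_coeff 2 l n 0 = of_nat (Suc n)"
  by (simp add: RC_coeff_def pochhammer_2 del: of_nat_Suc)

lemma RC_coeff_2_n: "RC_coeff k 2 n n = (- 1) ^ n * of_nat (Suc n)"
  by (simp add: RC_coeff_def pochhammer_2 del: of_nat_Suc)

section \<open>Rational scalars inside the algebra\<close>

context graded_algebra
begin

text \<open>Rational scalars as ring elements, so that \<open>scale_poly\<close> becomes
  \<open>smult\<close> and coefficients obey ring arithmetic.\<close>

definition rat_scalar :: "rat \<Rightarrow> 'a" where
  "rat_scalar r = scale (of_rat r) 1"

lemma scale_rat: "scale (of_rat r) x = rat_scalar r * x"
  using scale_mult_left[of "of_rat r" 1 x] by (simp add: rat_scalar_def)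

lemma scale_poly_rat: "scale_poly scale (of_rat r) p = smult (rat_scalar r) p"
  by (rule poly_eqI) (simp add: scale_poly_def coeff_map_poly scale_rat)

lemma rat_scalar_0 [simp]: "rat_scalar 0 = 0"
  and rat_scalar_1 [simp]: "rat_scalar 1 = 1"
  and rat_scalar_add: "rat_scalar (r + s) = rat_scalar r + rat_scalar s"
  and rat_scalar_minus: "rat_scalar (- r) = - rat_scalar r"
  by (simp_all add: rat_scalar_def of_rat_add of_rat_minus scale_left_distrib)

lemma rat_scalar_diff: "rat_scalar (r - s) = rat_scalar r - rat_scalar s"
  using rat_scalar_add[of r "- s"] by (simp add: rat_scalar_minus)

lemma rat_scalar_mult: "rat_scalar (r * s) = rat_scalar r * rat_scalar s"
  by (simp add: rat_scalar_def of_rat_mult flip: scale_scale scale_mult_left)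

lemma rat_scalar_of_nat [simp]: "rat_scalar (of_nat n) = of_nat n"
  by (induction n) (simp_all add: rat_scalar_add)

lemma rat_scalar_numeral [simp]: "rat_scalar (numeral n) = numeral n"
  using rat_scalar_of_nat[of "numeral n"] by simp

lemma rat_scalar_minus_one_power [simp]: "rat_scalar ((- 1) ^ n) = (- 1) ^ n"
  by (induction n) (simp_all add: rat_scalar_mult rat_scalar_minus)

text \<open>The ring may have zero divisors, but positive integers are invertible in it, since the
  base field has characteristic zero.\<close>

lemma of_nat_mult_eq_0D:
  assumes "of_nat (Suc n) * x = (0 :: 'a)"
  shows "x = 0"
proof -
  have "x = rat_scalar (1 / of_nat (Suc n) * of_nat (Suc n)) * x"
    by (simp del: of_nat_Suc)
  also have "\<dots> = rat_scalar (1 / of_nat (Suc n)) * (of_nat (Suc n) * x)"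
    by (simp add: rat_scalar_mult mult.assoc del: of_nat_Suc times_divide_eq_left)
  finally show ?thesis using assms by simp
qed

lemma const_of_formal_deriv_eq_0:
  assumes "formal_deriv p = (0 :: 'a poly)"
  shows "p = [:coeff p 0:]"
proof (rule poly_eqI)
  fix i
  show "coeff p i = coeff [:coeff p 0:] i"
  proof (cases i)
    case (Suc j)
    have "of_nat (Suc j) * coeff p (Suc j) = 0"
      using assms by (metis coeff_0 coeff_formal_deriv)
    then show ?thesis using of_nat_mult_eq_0D Suc by simp
  qed simp
qed

section \<open>The grading of the polynomial ring\<close>

lemma degree_add_int:
  assumes "k \<in> fractional_degrees N"
  shows "k + of_int i \<in> fractional_degrees N"
  using assms fractional_degrees_add of_int_fractional_degrees N_pos by blast

lemma degree_diff_nat: "k \<in> fractional_degrees N \<Longrightarrow> k - 2 * of_nat i \<in> fractional_degrees N"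
  using degree_add_int[of k "- 2 * int i"] by simp

lemma degree_add_nat: "k \<in> fractional_degrees N \<Longrightarrow> k + 2 * of_nat i \<in> fractional_degrees N"
  using degree_add_int[of k "2 * int i"] by simp

lemma degree_numeral: "numeral n \<in> fractional_degrees N"
  using of_int_fractional_degrees[OF N_pos, of "numeral n"] by simp

lemma component_zero: "k \<in> fractional_degrees N \<Longrightarrow> 0 \<in> M k"
  and component_add: "k \<in> fractional_degrees N \<Longrightarrow> x \<in> M k \<Longrightarrow> y \<in> M k \<Longrightarrow> x + y \<in> M k"
  and component_scale: "k \<in> fractional_degrees N \<Longrightarrow> x \<in> M k \<Longrightarrow> rat_scalar r * x \<in> M k"
  using subspace_component[of k]
  by (auto simp: subspace_0 subspace_add subspace_scale simp flip: scale_rat)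

text \<open>The grading with \<open>E2\<close> in degree 2, encoded coefficientwise so that
  membership can be unfolded along \<open>pCons\<close>.\<close>

definition poly_component :: "rat \<Rightarrow> 'a poly set" where
  "poly_component k = {p. \<forall>i. coeff p i \<in> M (k - 2 * of_nat i)}"

lemma poly_component_0: "k \<in> fractional_degrees N \<Longrightarrow> 0 \<in> poly_component k"
  by (simp add: poly_component_def component_zero degree_diff_nat)

lemma poly_component_add:
  "k \<in> fractional_degrees N \<Longrightarrow> p \<in> poly_component k \<Longrightarrow> q \<in> poly_component k \<Longrightarrow>
   p + q \<in> poly_component k"
  by (simp add: poly_component_def component_add degree_diff_nat)

lemma poly_component_smult:
  "k \<in> fractional_degrees N \<Longrightarrow> p \<in> poly_component k \<Longrightarrow>
   smult (rat_scalar r) p \<in> poly_component k"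
  by (simp add: poly_component_def component_scale degree_diff_nat)

lemma poly_component_diff:
  "k \<in> fractional_degrees N \<Longrightarrow> p \<in> poly_component k \<Longrightarrow> q \<in> poly_component k \<Longrightarrow>
   p - q \<in> poly_component k"
  using poly_component_add[of k p "- q"] poly_component_smult[of k q "- 1"]
  by (simp add: rat_scalar_minus)

lemma poly_component_sum:
  assumes "k \<in> fractional_degrees N" and "\<And>i. i \<in> A \<Longrightarrow> p i \<in> poly_component k"
  shows "sum p A \<in> poly_component k"
  using assms(2)
  by (induction A rule: infinite_finite_induct)
    (simp_all add: assms(1) poly_component_0 poly_component_add)

text \<open>The recursion behind the inductions on polynomials below: splitting off the constant
  term leaves a cofactor of \<open>E2\<close>, whose degree is lower by 2.\<close>

lemma poly_component_pCons:
  assumes "k \<in> fractional_degrees N"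
  shows "pCons a q \<in> poly_component k \<longleftrightarrow> a \<in> M k \<and> q \<in> poly_component (k - 2)"
proof -
  have "(\<forall>i. coeff (pCons a q) i \<in> M (k - 2 * of_nat i)) \<longleftrightarrow>
    a \<in> M k \<and> (\<forall>i. coeff q i \<in> M (k - 2 * of_nat (Suc i)))"
    by (auto simp: coeff_pCons split: nat.split)
  then show ?thesis by (simp add: poly_component_def algebra_simps)
qed

lemma poly_component_const:
  "k \<in> fractional_degrees N \<Longrightarrow> [:a:] \<in> poly_component k \<longleftrightarrow> a \<in> M k"
  using degree_diff_nat[of k 1] by (simp add: poly_component_pCons poly_component_0)

lemma E2_poly_component: "E2 \<in> poly_component 2"
proof -
  have "(0 :: rat) \<in> fractional_degrees N"
    using of_int_fractional_degrees[OF N_pos, of 0] by simp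
  then show ?thesis
    using poly_component_const[of 0 1]
    by (simp add: E2_def poly_component_pCons degree_numeral component_zero one_component)
qed

lemma poly_component_mult:
  assumes k: "k \<in> fractional_degrees N" and l: "l \<in> fractional_degrees N"
    and p: "p \<in> poly_component k" and q: "q \<in> poly_component l"
  shows "p * q \<in> poly_component (k + l)"
  unfolding poly_component_def mem_Collect_eq coeff_mult
proof
  fix n
  have "coeff p i * coeff q (n - i) \<in> M (k + l - 2 * of_nat n)" if "i \<le> n" for i
  proof -
    have "coeff p i * coeff q (n - i) \<in> M ((k - 2 * of_nat i) + (l - 2 * of_nat (n - i)))"
      using p q by (intro mult_component degree_diff_nat k l) (auto simp: poly_component_def)
    then show ?thesis using that by (simp add: of_nat_diff algebra_simps)
  qed
  then show "(\<Sum>i\<le>n. coeff p i * coeff q (n - i)) \<in> M (k + l - 2 * of_nat n)"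
    by (intro subspace_sum[OF subspace_component] degree_diff_nat fractional_degrees_add k l) simp
qed

lemma const_of_formal_deriv_eq_0_component:
  assumes "k \<in> fractional_degrees N" "p \<in> poly_component k" "formal_deriv p = 0"
  shows "p \<in> (\<lambda>m. [:m:]) ` M k"
proof -
  have "p = [:coeff p 0:]" by (rule const_of_formal_deriv_eq_0) fact
  then show ?thesis using assms(1,2) poly_component_const by (metis image_eqI)
qed

end

section \<open>The derivation \<open>D\<close> and its commutator with
  \<open>formal_deriv\<close>\<close>

locale quasimodular_derivation = graded_algebra scale N M
  for scale :: "'k::field_char_0 \<Rightarrow> 'a::comm_ring_1 \<Rightarrow> 'a" and N M +
  fixes d :: "'a \<Rightarrow> 'a" and E4 :: 'a and D :: "'a poly \<Rightarrow> 'a poly"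
  assumes degree_d: "has_degree_2 N M d"
    and E4: "E4 \<in> M 4"
    and ext: "extends_derivation scale N M d E4 D"
begin

lemma D_add: "D (p + q) = D p + D q"
  and D_mult: "D (p * q) = D p * q + p * D q"
  and D_E2: "D E2 = [:E4:] + E2 ^ 2"
  using ext by (simp_all add: extends_derivation_def is_derivation_def)

lemma D_smult: "D (smult (rat_scalar r) p) = smult (rat_scalar r) (D p)"
  using ext by (simp add: extends_derivation_def is_derivation_def flip: scale_poly_rat)

lemma D_0: "D 0 = 0"
  using D_add[of 0 0] by simp

lemma D_1: "D 1 = 0"
  using D_mult[of 1 1] by simp

lemma D_const:
  "k \<in> fractional_degrees N \<Longrightarrow> a \<in> M k \<Longrightarrow> D [:a:] = [:d a:] + smult (rat_scalar k) (E2 * [:a:])"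
  using ext by (simp add: extends_derivation_def scale_poly_rat)

lemma pCons_eq_E2: "pCons a q = [:a:] + E2 * q"
  by (simp add: E2_def)

lemma D_pCons:
  assumes "k \<in> fractional_degrees N" "a \<in> M k"
  shows "D (pCons a q) =
    [:d a:] + smult (rat_scalar k) (E2 * [:a:]) + ([:E4:] + E2 ^ 2) * q + E2 * D q"
  by (subst pCons_eq_E2) (simp only: D_add D_mult D_E2 D_const[OF assms] add.assoc)

text \<open>Each term of \<open>D_pCons\<close> is homogeneous of degree \<open>k + 2\<close>; for
  the third, \<open>[:E4:] + E2 ^ 2\<close> has degree 4 and \<open>q\<close> has degree
  \<open>k - 2\<close>. The latter is why \<open>k\<close> varies in the induction.\<close>

lemma D_poly_component:
  "k \<in> fractional_degrees N \<Longrightarrow> p \<in> poly_component k \<Longrightarrow> D p \<in> poly_component (k + 2)"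
proof (induction p arbitrary: k)
  case 0
  then show ?case using degree_add_nat[of k 1] by (simp add: D_0 poly_component_0)
next
  case (pCons a q)
  note k = pCons.prems(1)
  have k2: "k + 2 \<in> fractional_degrees N" "k - 2 \<in> fractional_degrees N"
    using degree_add_nat[OF k, of 1] degree_diff_nat[OF k, of 1] by simp_all
  have a: "a \<in> M k" and q: "q \<in> poly_component (k - 2)"
    using pCons.prems by (simp_all add: poly_component_pCons)
  have "[:d a:] \<in> poly_component (k + 2)"
    using a k degree_d by (auto simp: poly_component_const k2 has_degree_2_def)
  moreover have "E2 * [:a:] \<in> poly_component (k + 2)"
    using poly_component_mult[OF degree_numeral k E2_poly_component, of "[:a:]"] a k
    by (simp only: poly_component_const add.commute[of k])
  moreover have "[:E4:] + E2 ^ 2 \<in> poly_component 4"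
    using poly_component_mult[OF degree_numeral degree_numeral E2_poly_component E2_poly_component]
    by (intro poly_component_add degree_numeral)
      (simp_all add: poly_component_const degree_numeral E4 power2_eq_square)
  then have "([:E4:] + E2 ^ 2) * q \<in> poly_component (4 + (k - 2))"
    by (rule poly_component_mult[OF degree_numeral k2(2) _ q])
  then have "([:E4:] + E2 ^ 2) * q \<in> poly_component (k + 2)"
    by (rule back_subst[of "\<lambda>l. _ \<in> poly_component l"]) simp
  moreover have "E2 * D q \<in> poly_component (k + 2)"
    using poly_component_mult[OF degree_numeral k E2_poly_component, of "D q"] pCons.IH[OF k2(2) q]
    by (simp only: diff_add_cancel add.commute[of k])
  ultimately show ?case
    unfolding D_pCons[OF k a] by (intro poly_component_add poly_component_smult k2)
qed

lemma D_funpow_poly_component: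
  assumes k: "k \<in> fractional_degrees N" and "p \<in> poly_component k"
  shows "(D ^^ m) p \<in> poly_component (k + 2 * of_nat m)"
proof (induction m)
  case (Suc m)
  then show ?case
    using D_poly_component[OF degree_add_nat[OF k] Suc] by (simp add: algebra_simps)
qed (use assms in simp)

text \<open>The commutator is the Euler operator: \<open>k\<close> is the total degree, powers of
  \<open>E2\<close> included.\<close>

lemma formal_deriv_D:
  "k \<in> fractional_degrees N \<Longrightarrow> p \<in> poly_component k \<Longrightarrow>
   formal_deriv (D p) = D (formal_deriv p) + smult (rat_scalar k) p"
proof (induction p arbitrary: k)
  case 0
  then show ?case by (simp add: D_0)
next
  case (pCons a q)
  note k = pCons.prems(1)
  have k2: "k - 2 \<in> fractional_degrees N"
    using degree_diff_nat[OF k, of 1] by simp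
  have a: "a \<in> M k" and q: "q \<in> poly_component (k - 2)"
    using pCons.prems by (simp_all add: poly_component_pCons)
  \<comment> \<open>The scalar becomes a constant polynomial, so that the computation is a ring
    identity.\<close>
  define e where "e = [:rat_scalar k:]"
  have e: "smult (rat_scalar k) p = e * p" for p
    by (simp add: e_def)
  have IH: "formal_deriv (D q) = D (formal_deriv q) + (e - 2) * q"
    using pCons.IH[OF k2 q] by (simp add: rat_scalar_diff smult_diff_left e algebra_simps numeral_poly)
  have de: "formal_deriv e = 0" "formal_deriv [:b:] = 0" for b
    by (simp_all add: e_def formal_deriv_const)
  have "formal_deriv (D (pCons a q)) =
    e * [:a:] + 2 * E2 * q + ([:E4:] + E2 ^ 2) * formal_deriv q + D q + E2 * formal_deriv (D q)"
    unfolding D_pCons[OF k a] e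
    by (simp only: formal_deriv_add formal_deriv_mult de formal_deriv_E2 power2_eq_square)
      (simp add: algebra_simps)
  \<comment> \<open>The term \<open>2 * E2 * q\<close>, from differentiating \<open>E2 ^ 2\<close>,
    makes up for the degree \<open>k - 2\<close> of \<open>q\<close> in the induction
    hypothesis.\<close>
  also have "\<dots> = (D q + (([:E4:] + E2 ^ 2) * formal_deriv q + E2 * D (formal_deriv q))) + e * ([:a:] + E2 * q)"
    unfolding IH by (simp only: algebra_simps mult_2)
  also have "D q + (([:E4:] + E2 ^ 2) * formal_deriv q + E2 * D (formal_deriv q)) = D (formal_deriv (pCons a q))"
    unfolding pCons_eq_E2[of a q]
    by (simp only: formal_deriv_add formal_deriv_mult de formal_deriv_E2 D_add D_mult D_E2)
      (simp add: D_0 D_1 algebra_simps)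
  finally show ?case unfolding e pCons_eq_E2[of a q] .
qed

text \<open>Moving \<open>formal_deriv\<close> past each \<open>D\<close> contributes the degree
  \<open>k + 2 * i\<close> of \<open>(D ^^ i) p\<close>; these add up to the stated factor. The
  hypothesis on \<open>formal_deriv p\<close> covers constants, where it is 0, and
  \<open>E2\<close>, where it is 1.\<close>

lemma formal_deriv_D_funpow:
  assumes k: "k \<in> fractional_degrees N" and p: "p \<in> poly_component k" and "D (formal_deriv p) = 0"
  shows "formal_deriv ((D ^^ Suc m) p) =
    smult (rat_scalar (of_nat (Suc m) * (k + of_nat m))) ((D ^^ m) p)"
proof (induction m)
  case 0
  then show ?case using formal_deriv_D[OF k p] assms(3) by simp
next
  case (Suc m)
  have "formal_deriv ((D ^^ Suc (Suc m)) p) = D (formal_deriv ((D ^^ Suc m) p)) +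
      smult (rat_scalar (k + 2 * of_nat (Suc m))) ((D ^^ Suc m) p)"
    using formal_deriv_D[OF degree_add_nat[OF k] D_funpow_poly_component[OF k p, of "Suc m"]]
    by simp
  also have "\<dots> = smult (rat_scalar (of_nat (Suc m) * (k + of_nat m) + (k + 2 * of_nat (Suc m))))
      ((D ^^ Suc m) p)"
    unfolding Suc by (simp add: D_smult rat_scalar_add smult_add_left)
  also have "of_nat (Suc m) * (k + of_nat m) + (k + 2 * of_nat (Suc m)) =
      of_nat (Suc (Suc m)) * (k + of_nat (Suc m))"
    by (simp add: algebra_simps)
  finally show ?case .
qed

section \<open>Degree and derivative of the Rankin--Cohen bracket\<close>

lemma RC_bracket_eq:
  "RC_bracket scale D k l n f g =
   (\<Sum>j\<le>n. smult (rat_scalar (RC_coeff k l n j)) ((D ^^ j) f * (D ^^ (n - j)) g))"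
  by (simp add: RC_bracket_def scale_poly_rat RC_coeff_def atMost_atLeast0)

lemma RC_bracket_poly_component:
  assumes k: "k \<in> fractional_degrees N" and l: "l \<in> fractional_degrees N"
    and f: "f \<in> poly_component k" and g: "g \<in> poly_component l"
  shows "RC_bracket scale D k l n f g \<in> poly_component (k + l + 2 * of_nat n)"
  unfolding RC_bracket_eq
proof (intro poly_component_sum poly_component_smult degree_add_nat fractional_degrees_add k l)
  fix j assume "j \<in> {..n}"
  then show "(D ^^ j) f * (D ^^ (n - j)) g \<in> poly_component (k + l + 2 * of_nat n)"
    using poly_component_mult[OF degree_add_nat[OF k] degree_add_nat[OF l]
        D_funpow_poly_component[OF k f, of j] D_funpow_poly_component[OF l g, of "n - j"]]
    by (simp add: of_nat_diff algebra_simps)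
qed

text \<open>The Leibniz rule gives one sum per differentiated factor. The terms that survive are
  those where the differentiated factor carries no \<open>D\<close>: \<open>j = 0\<close> for
  \<open>f\<close> and \<open>j = n\<close> for \<open>g\<close>.\<close>

lemma formal_deriv_RC_bracket:
  assumes k: "k \<in> fractional_degrees N" and l: "l \<in> fractional_degrees N"
    and f: "f \<in> poly_component k" and g: "g \<in> poly_component l"
    and f0: "D (formal_deriv f) = 0" and g0: "D (formal_deriv g) = 0"
  shows "formal_deriv (RC_bracket scale D k l n f g) =
    smult (rat_scalar (RC_coeff k l n 0)) (formal_deriv f * (D ^^ n) g) +
    smult (rat_scalar (RC_coeff k l n n)) ((D ^^ n) f * formal_deriv g)"
proof -
  define c where "c j = rat_scalar (RC_coeff k l n j)" for j
  \<comment> \<open>Splitting off \<open>j = 0\<close> and shifting the index aligns the products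
    with those in \<open>G\<close>.\<close>
  have F: "(\<Sum>j\<le>n. smult (c j) (formal_deriv ((D ^^ j) f) * (D ^^ (n - j)) g)) =
      smult (c 0) (formal_deriv f * (D ^^ n) g) +
      (\<Sum>j<n. smult (rat_scalar (RC_coeff k l n (Suc j) * (of_nat (Suc j) * (k + of_nat j))))
         ((D ^^ j) f * (D ^^ (n - Suc j)) g))"
    unfolding sum.atMost_shift
    by (simp add: formal_deriv_D_funpow[OF k f f0] rat_scalar_mult c_def
        del: funpow.simps(2) of_nat_Suc)
  \<comment> \<open>Here the last summand \<open>j = n\<close> is split off, with no shift.\<close>
  have G: "(\<Sum>j\<le>n. smult (c j) ((D ^^ j) f * formal_deriv ((D ^^ (n - j)) g))) =
      (\<Sum>j<n. smult (rat_scalar (RC_coeff k l n j * (of_nat (n - j) * (l + of_nat (n - j) - 1))))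
         ((D ^^ j) f * (D ^^ (n - Suc j)) g)) +
      smult (c n) ((D ^^ n) f * formal_deriv g)"
  proof -
    have "smult (c j) ((D ^^ j) f * formal_deriv ((D ^^ (n - j)) g)) =
        smult (rat_scalar (RC_coeff k l n j * (of_nat (n - j) * (l + of_nat (n - j) - 1))))
         ((D ^^ j) f * (D ^^ (n - Suc j)) g)" if j: "j < n" for j
    proof -
      have *: "n - j = Suc (n - Suc j)" using j by simp
      have "formal_deriv ((D ^^ (n - j)) g) =
          smult (rat_scalar (of_nat (n - j) * (l + of_nat (n - j) - 1))) ((D ^^ (n - Suc j)) g)"
        using formal_deriv_D_funpow[OF l g g0, of "n - Suc j"] unfolding * by (simp add: algebra_simps)
      then show ?thesis by (simp add: rat_scalar_mult c_def mult.assoc)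
    qed
    then show ?thesis by (simp add: lessThan_Suc_atMost[symmetric])
  qed
  have cancel: "(\<Sum>j<n. smult (rat_scalar (RC_coeff k l n (Suc j) * (of_nat (Suc j) * (k + of_nat j))))
         ((D ^^ j) f * (D ^^ (n - Suc j)) g)) =
      - (\<Sum>j<n. smult (rat_scalar (RC_coeff k l n j * (of_nat (n - j) * (l + of_nat (n - j) - 1))))
         ((D ^^ j) f * (D ^^ (n - Suc j)) g))"
    unfolding sum_negf[symmetric]
    by (intro sum.cong refl) (simp only: lessThan_iff RC_coeff_Suc rat_scalar_minus smult_minus_left)
  have "formal_deriv (RC_bracket scale D k l n f g) =
      (\<Sum>j\<le>n. smult (c j) (formal_deriv ((D ^^ j) f) * (D ^^ (n - j)) g)) +
      (\<Sum>j\<le>n. smult (c j) ((D ^^ j) f * formal_deriv ((D ^^ (n - j)) g)))"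
    by (simp add: RC_bracket_eq formal_deriv_sum formal_deriv_smult formal_deriv_mult c_def smult_add_right
        sum.distrib algebra_simps)
  then show ?thesis unfolding F G cancel by (simp add: c_def)
qed

section \<open>The two expressions lie in \<open>M\<close>\<close>

text \<open>Only the boundary term with \<open>formal_deriv E2 = 1\<close> survives in the bracket,
  giving \<open>n + 1\<close> times \<open>(D ^^ n) [:f:]\<close>. The iterated derivative gives
  \<open>(n + 1) * (k + n)\<close> times the same element, which the factor \<open>n + k\<close>
  balances.\<close>

lemma theta_component:
  assumes k: "k \<in> fractional_degrees N" and f: "f \<in> M k"
  shows "theta scale D n k f \<in> (\<lambda>m. [:m:]) ` M (k + 2 + 2 * of_nat n)"
proof (rule const_of_formal_deriv_eq_0_component)
  note two = degree_numeral[of "num.Bit0 num.One"]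
  have fk: "[:f:] \<in> poly_component k" using k f by (simp add: poly_component_const)
  have f0: "formal_deriv [:f:] = 0" by (rule formal_deriv_const)
  show deg: "k + 2 + 2 * of_nat n \<in> fractional_degrees N"
    using degree_add_nat[OF k, of "Suc n"] by (simp add: algebra_simps)
  have "(D ^^ (n + 1)) [:f:] \<in> poly_component (k + 2 + 2 * of_nat n)"
    using D_funpow_poly_component[OF k fk, of "n + 1"] by (simp add: algebra_simps)
  moreover have "RC_bracket scale D 2 k n E2 [:f:] \<in> poly_component (k + 2 + 2 * of_nat n)"
    using RC_bracket_poly_component[OF two k E2_poly_component fk, of n] by (simp add: algebra_simps)
  ultimately show "theta scale D n k f \<in> poly_component (k + 2 + 2 * of_nat n)"
    unfolding theta_def scale_poly_rat by (intro poly_component_diff poly_component_smult deg)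
  have "formal_deriv (RC_bracket scale D 2 k n E2 [:f:]) =
      smult (rat_scalar (of_nat (Suc n))) ((D ^^ n) [:f:])"
    using formal_deriv_RC_bracket[OF two k E2_poly_component fk, of n]
    by (simp only: formal_deriv_E2 f0 D_0 D_1 RC_coeff_2_0) simp
  moreover have "formal_deriv ((D ^^ (n + 1)) [:f:]) =
      smult (rat_scalar (of_nat (Suc n) * (k + of_nat n))) ((D ^^ n) [:f:])"
    using formal_deriv_D_funpow[OF k fk, of n] by (simp only: f0 D_0 Suc_eq_plus1)
  ultimately show "formal_deriv (theta scale D n k f) = 0"
    unfolding theta_def scale_poly_rat formal_deriv_diff formal_deriv_smult
    by (simp only: smult_smult flip: rat_scalar_mult) (simp add: algebra_simps)
qed

text \<open>Now both boundary terms survive, with coefficients \<open>n + 1\<close> and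
  \<open>(- 1) ^ n * (n + 1)\<close>; this accounts for the factor \<open>1 + (- 1) ^ n\<close>. The
  factor \<open>n + 2\<close> is matched by \<open>formal_deriv_D_funpow\<close> at
  \<open>k = 2\<close>.\<close>

lemma theta_E2_component: "theta_E2 scale D n \<in> (\<lambda>m. [:m:]) ` M (4 + 2 * of_nat n)"
proof (rule const_of_formal_deriv_eq_0_component)
  note two = degree_numeral[of "num.Bit0 num.One"]
  note E2c = E2_poly_component
  define a where "a = rat_scalar (1 + (- 1) ^ n)"
  define b where "b = rat_scalar (of_nat n + 2)"
  \<comment> \<open>The integer factors in \<open>theta_E2\<close> are polynomials; they are turned
    into scalars so that the \<open>smult\<close> rules apply.\<close>
  have theta: "theta_E2 scale D n =
      smult a ((D ^^ (n + 1)) E2) - smult b (RC_bracket scale D 2 2 n E2 E2)"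
  proof -
    have "(- 1) ^ n = ([:(- 1) ^ n:] :: 'a poly)"
      by (induction n) (simp_all add: one_pCons)
    then have "1 + (- 1) ^ n = [:a:]"
      by (simp add: a_def rat_scalar_add one_pCons)
    moreover have "of_nat n + 2 = [:b:]"
      by (simp add: b_def rat_scalar_add of_nat_poly numeral_poly)
    ultimately show ?thesis by (simp add: theta_E2_def)
  qed
  show deg: "4 + 2 * of_nat n \<in> fractional_degrees N"
    by (intro degree_add_nat degree_numeral)
  have "(D ^^ (n + 1)) E2 \<in> poly_component (4 + 2 * of_nat n)"
    using D_funpow_poly_component[OF two E2c, of "n + 1"] by (simp add: algebra_simps)
  moreover have "RC_bracket scale D 2 2 n E2 E2 \<in> poly_component (4 + 2 * of_nat n)"
    using RC_bracket_poly_component[OF two two E2c E2c, of n] by simp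
  ultimately show "theta_E2 scale D n \<in> poly_component (4 + 2 * of_nat n)"
    unfolding theta a_def b_def by (intro poly_component_diff poly_component_smult deg)
  have "formal_deriv (RC_bracket scale D 2 2 n E2 E2) =
      smult (a * of_nat (Suc n)) ((D ^^ n) E2)"
    using formal_deriv_RC_bracket[OF two two E2c E2c, of n]
    by (simp only: formal_deriv_E2 D_1 RC_coeff_2_0 RC_coeff_2_n)
      (simp add: a_def rat_scalar_add rat_scalar_mult distrib_right
        del: of_nat_Suc flip: smult_add_left)
  moreover have "formal_deriv ((D ^^ (n + 1)) E2) = smult (of_nat (Suc n) * b) ((D ^^ n) E2)"
    using formal_deriv_D_funpow[OF two E2c, of n]
    by (simp only: formal_deriv_E2 D_1 Suc_eq_plus1)
      (simp add: b_def rat_scalar_mult rat_scalar_add algebra_simps)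
  ultimately show "formal_deriv (theta_E2 scale D n) = 0"
    unfolding theta formal_deriv_diff formal_deriv_smult by (simp add: algebra_simps)
qed

end

theorem theorem1p2:
  fixes scale :: "'k::field_char_0 \<Rightarrow> 'a::comm_ring_1 \<Rightarrow> 'a"
    and N :: nat and M :: "rat \<Rightarrow> 'a set"
    and d :: "'a \<Rightarrow> 'a" and E4 :: 'a
    and D :: "'a poly \<Rightarrow> 'a poly"
    and n :: nat
  assumes "graded_algebra scale N M"
    and "is_derivation scale d" and "has_degree_2 N M d"
    and "E4 \<in> M 4"
    and "extends_derivation scale N M d E4 D"
  shows "(\<forall>k\<in>fractional_degrees N. \<forall>f\<in>M k.
            theta scale D n k f \<in> (\<lambda>m. [:m:]) ` M (k + 2 + 2 * of_nat n)) \<and>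
         theta_E2 scale D n \<in> (\<lambda>m. [:m:]) ` M (4 + 2 * of_nat n)"
proof -
  interpret graded_algebra scale N M by fact
  interpret quasimodular_derivation scale N M d E4 D
    by unfold_locales fact+
  show ?thesis using theta_component theta_E2_component by blast
qed

end
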